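(* For all integers $n,m\ge 1$, the comb graph $C_{n,m}$ satisfies $b(C_{n,m}) \le \lceil \sqrt{nm}\,\rceil$.
   Context: The burning number of a graph $G$ is $b(G)=\min\{k : \exists v_1,\dots,v_k\in V(G) \text{ with } V(G)=\bigcup_{i=1}^k B(v_i,k-i)\}$, where $B(v,r)$ is the set of vertices at graph distance at most $r$ from $v$. The comb graph $C_{n,m}$ is the rooted product $P_n\circ P_m$ with root an end-vertex of $P_m$: it has vertex set $\{(i,j): 1\le i\le m,\ 1\le j\le n\}$, with edges $(1,j)\sim(1,j+1)$ for $1\le j<n$ (the spine) and $(i,j)\sim(i+1,j)$ for $1\le i<m$ (tooth $j$). It has $nm$ vertices. *)

theory Defs
  imports Complex_Main "Graph_Theory.Graph_Theory"
begin

text \<open>Undirected graphs are represented as symmetric digraphs (each edge contributes both arcs).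
  Graph distance is the shortest-path distance for the constant arc weight 1; it is
  \<open>\<infinity>\<close> between vertices in different components.\<close>

definition graph_dist :: "('a, 'b) pre_digraph \<Rightarrow> 'a \<Rightarrow> 'a \<Rightarrow> ereal" where
  "graph_dist G u v = wf_digraph.\<mu> G (\<lambda>_. 1) u v"

definition graph_ball :: "('a, 'b) pre_digraph \<Rightarrow> 'a \<Rightarrow> nat \<Rightarrow> 'a set" where
  "graph_ball G v r = {u \<in> verts G. graph_dist G v u \<le> ereal (real r)}"

definition burning_seq :: "('a, 'b) pre_digraph \<Rightarrow> nat \<Rightarrow> (nat \<Rightarrow> 'a) \<Rightarrow> bool" where
  "burning_seq G k v \<longleftrightarrow>
     (\<forall>i\<in>{1..k}. v i \<in> verts G) \<and> verts G = (\<Union>i\<in>{1..k}. graph_ball G (v i) (k - i))"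

definition burning_number :: "('a, 'b) pre_digraph \<Rightarrow> nat" where
  "burning_number G = (LEAST k. \<exists>v. burning_seq G k v)"

definition comb_edges :: "nat \<Rightarrow> nat \<Rightarrow> ((nat \<times> nat) \<times> (nat \<times> nat)) set" where
  "comb_edges n m =
     {((1, j), (1, j + 1)) | j. 1 \<le> j \<and> j < n} \<union>
     {((i, j), (i + 1, j)) | i j. 1 \<le> i \<and> i < m \<and> 1 \<le> j \<and> j \<le> n}"

definition comb_graph :: "nat \<Rightarrow> nat \<Rightarrow> (nat \<times> nat) pair_pre_digraph" where
  "comb_graph n m =
     \<lparr> pverts = {1..m} \<times> {1..n}, parcs = comb_edges n m \<union> (comb_edges n m)\<inverse> \<rparr>"

lemma card_verts_comb_graph: "card (pverts (comb_graph n m)) = n * m"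
  by (simp add: comb_graph_def)

lemma pair_graph_comb_graph:
  assumes "m \<ge> 1"
  shows "pair_graph (comb_graph n m)"
proof -
  have sub: "parcs (comb_graph n m) \<subseteq> pverts (comb_graph n m) \<times> pverts (comb_graph n m)"
    using assms by (auto simp: comb_graph_def comb_edges_def)
  have fin: "finite (pverts (comb_graph n m))"
    by (simp add: comb_graph_def)
  show ?thesis
  proof
    show "fst e \<in> pverts (comb_graph n m)" if "e \<in> parcs (comb_graph n m)" for e
      using that sub by auto
    show "snd e \<in> pverts (comb_graph n m)" if "e \<in> parcs (comb_graph n m)" for e
      using that sub by auto
    show "finite (pverts (comb_graph n m))" by (fact fin)
    show "finite (parcs (comb_graph n m))"
      by (rule finite_subset[OF sub]) (simp add: fin)
    show "fst e \<noteq> snd e" if "e \<in> parcs (comb_graph n m)" for e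
      using that by (auto simp: comb_graph_def comb_edges_def)
    have "sym (parcs (comb_graph n m))"
      by (auto simp: comb_graph_def intro: symI)
    then show "symmetric (with_proj (comb_graph n m))"
      by (simp add: symmetric_def)
  qed
qed

lemma graph_dist_le_iff:
  fixes G (structure)
  assumes "wf_digraph G"
  shows "graph_dist G u v \<le> ereal (real r) \<longleftrightarrow>
    (\<exists>p. pre_digraph.awalk G u p v \<and> length p \<le> r)"
proof -
  interpret wf_digraph G by fact
  have cost: "awalk_cost (\<lambda>_. 1) p = real (length p)" for p
    by (induction p) auto
  have eq: "graph_dist G u v = (INF p\<in>{p. awalk u p v}. ereal (real (length p)))"
    by (simp add: graph_dist_def \<mu>_def cost)
  show ?thesis
  proof
    assume "graph_dist G u v \<le> ereal (real r)"
    then have "graph_dist G u v < ereal (real r + 1)"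
      by (rule le_less_trans) simp
    then obtain p where "awalk u p v" "ereal (real (length p)) < ereal (real r + 1)"
      unfolding eq INF_less_iff by auto
    then show "\<exists>p. awalk u p v \<and> length p \<le> r" by auto
  next
    assume "\<exists>p. awalk u p v \<and> length p \<le> r"
    then show "graph_dist G u v \<le> ereal (real r)"
      unfolding eq by (auto intro: INF_lower2)
  qed
qed

text \<open>For a finite graph the minimum in the definition of the burning number is over a nonempty
  set, so \<open>LEAST\<close> is meaningful.\<close>

lemma burning_seq_exists:
  fixes G (structure)
  assumes "fin_digraph G"
  shows "\<exists>k v. burning_seq G k v"
proof -
  interpret fin_digraph G by fact
  define k where "k = card (verts G)"
  obtain f where f: "bij_betw f {0..<k} (verts G)"
    using ex_bij_betw_nat_finite[OF finite_verts] unfolding k_def by blast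
  define v where "v i = f (i - 1)" for i
  have mem: "v i \<in> verts G" if "i \<in> {1..k}" for i
    using that f unfolding v_def bij_betw_def by auto
  have self: "u \<in> graph_ball G u r" if "u \<in> verts G" for u r
    using that awalk_Nil_iff[of u u]
    by (auto simp: graph_ball_def graph_dist_le_iff[OF wf_digraph_axioms] intro!: exI[of _ "[]"])
  have "\<exists>i\<in>{1..k}. u = v i" if u: "u \<in> verts G" for u
  proof -
    obtain x where "x < k" "u = f x"
      using u f unfolding bij_betw_def by (metis atLeastLessThan_iff imageE)
    then show ?thesis by (intro bexI[of _ "Suc x"]) (auto simp: v_def)
  qed
  then have "verts G \<subseteq> (\<Union>i\<in>{1..k}. graph_ball G (v i) (k - i))"
    using self by blast
  moreover have "(\<Union>i\<in>{1..k}. graph_ball G (v i) (k - i)) \<subseteq> verts G"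
    by (auto simp: graph_ball_def)
  ultimately have "burning_seq G k v"
    using mem unfolding burning_seq_def by blast
  then show ?thesis by blast
qed

end

theory Submission
  imports Defs
begin

text \<open>Let \<open>k\<^sup>2 \<ge> n m\<close>; the comb has to be covered by balls of radii \<open>0, \<dots>, k - 1\<close>. If \<open>m \<le> k\<close> and
  \<open>n > 2 k - m\<close>, balls centred on the spine suffice; for \<open>n = 1\<close> the comb is a path,
  which is cut into intervals. Otherwise the largest ball goes to the middle
  of the spine, and each of the other balls is an interval of \<open>2 r + 1\<close> vertices in the part of a
  single tooth left uncovered. For \<open>m \<le> k\<close> one interval per tooth is enough. For \<open>m > k\<close> the radii
  are distributed by repeatedly pairing the \<open>2 n\<close> largest ones, the smallest with the largest, so
  that every tooth receives the same total.\<close>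

section \<open>Covering integer intervals by shorter ones\<close>

text \<open>The intervals are laid end to end: the one of a new radius starts right after the
  stretch already covered.\<close>

lemma interval_cover:
  fixes a :: int
  assumes "finite R"
  shows "\<exists>c. \<forall>x. a < x \<and> x \<le> a + (\<Sum>r\<in>R. 2 * int r + 1) \<longrightarrow> (\<exists>r\<in>R. \<bar>x - c r\<bar> \<le> int r)"
  using assms
proof (induction R)
  case empty
  then show ?case by auto
next
  case (insert s R)
  then obtain c where c: "\<And>x. a < x \<Longrightarrow> x \<le> a + (\<Sum>r\<in>R. 2 * int r + 1) \<Longrightarrow> \<exists>r\<in>R. \<bar>x - c r\<bar> \<le> int r"
    by blast
  let ?S = "\<Sum>r\<in>R. 2 * int r + 1"
  let ?c = "c(s := a + ?S + int s + 1)"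
  have "\<exists>r\<in>insert s R. \<bar>x - ?c r\<bar> \<le> int r"
    if x: "a < x" "x \<le> a + (\<Sum>r\<in>insert s R. 2 * int r + 1)" for x
  proof (cases "x \<le> a + ?S")
    case True
    then obtain r where "r \<in> R" "\<bar>x - c r\<bar> \<le> int r" using c x(1) by blast
    then show ?thesis using insert.hyps by (intro bexI[of _ r]) auto
  next
    case False
    then show ?thesis using x insert.hyps by (intro bexI[of _ s]) auto
  qed
  then show ?case by blast
qed

text \<open>Clamping a centre into \<open>{1..m}\<close> takes it no farther from any point of
  \<open>{1..m}\<close>. For \<open>L \<le> 0\<close> there is nothing to cover.\<close>

lemma interval_cover_within:
  fixes L :: int
  assumes "finite R" and "L \<le> (\<Sum>r\<in>R. 2 * int r + 1)" and "m \<ge> 1"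
  shows "\<exists>c. (\<forall>r. c r \<in> {1..m}) \<and>
    (\<forall>x\<in>{1..m}. int m - L < int x \<longrightarrow> (\<exists>r\<in>R. \<bar>int x - int (c r)\<bar> \<le> int r))"
proof -
  obtain c where c: "\<And>x. int m - L < x \<Longrightarrow> x \<le> int m - L + (\<Sum>r\<in>R. 2 * int r + 1)
      \<Longrightarrow> \<exists>r\<in>R. \<bar>x - c r\<bar> \<le> int r"
    using interval_cover[OF assms(1), of "int m - L"] by blast
  define d where "d r = nat (max 1 (min (int m) (c r)))" for r
  have int_d: "int (d r) = max 1 (min (int m) (c r))" for r
    unfolding d_def by simp
  have "\<exists>r\<in>R. \<bar>int x - int (d r)\<bar> \<le> int r" if x: "x \<in> {1..m}" "int m - L < int x" for x
  proof -
    obtain r where "r \<in> R" "\<bar>int x - c r\<bar> \<le> int r"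
      using c[of "int x"] x assms(2) by force
    then show ?thesis using x(1) int_d[of r] by (intro bexI[of _ r]) auto
  qed
  moreover have "d r \<in> {1..m}" for r
    using int_d[of r] assms(3) by auto
  ultimately show ?thesis by blast
qed

lemma sum_odd_int: "(\<Sum>r<k. 2 * int r + 1) = int k ^ 2"
  by (induction k) (auto simp: power2_eq_square algebra_simps)

section \<open>Walks in the comb\<close>

text \<open>By \<open>graph_dist_le_iff\<close> this is distance at most \<open>r\<close>; with
  explicit walks the triangle inequality is concatenation.\<close>

definition walk_within :: "nat \<Rightarrow> nat \<Rightarrow> nat \<Rightarrow> nat \<times> nat \<Rightarrow> nat \<times> nat \<Rightarrow> bool" where
  "walk_within n m r u v \<longleftrightarrow>
     (\<exists>p. pre_digraph.awalk (with_proj (comb_graph n m)) u p v \<and> length p \<le> r)"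

context
  fixes n m :: nat
  assumes m_pos: "m \<ge> 1"
begin

interpretation pair_graph "comb_graph n m"
  by (rule pair_graph_comb_graph[OF m_pos])

lemma walk_within_refl: "u \<in> {1..m} \<times> {1..n} \<Longrightarrow> walk_within n m r u u"
  unfolding walk_within_def
  by (intro exI[of _ "[]"]) (simp add: awalk_Nil_iff, simp add: comb_graph_def)

lemma walk_within_trans:
  assumes "walk_within n m r u v" "walk_within n m s v w" "r + s \<le> q"
  shows "walk_within n m q u w"
proof -
  obtain p p' where "awalk u p v" "length p \<le> r" "awalk v p' w" "length p' \<le> s"
    using assms(1,2) unfolding walk_within_def by auto
  then have "awalk u (p @ p') w" "length (p @ p') \<le> q"
    using assms(3) by (auto intro: awalk_appendI)
  then show ?thesis unfolding walk_within_def by blast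
qed

lemma walk_within_arc:
  "(u, v) \<in> comb_edges n m \<union> (comb_edges n m)\<inverse> \<Longrightarrow> walk_within n m 1 u v"
  using arc_implies_awalk[of "(u, v)"] unfolding walk_within_def
  by (intro exI[of _ "[(u, v)]"]) (simp add: comb_graph_def)

lemma walk_within_tooth_asc:
  "1 \<le> i \<Longrightarrow> i + d \<le> m \<Longrightarrow> j \<in> {1..n} \<Longrightarrow>
    walk_within n m d (i, j) (i + d, j) \<and> walk_within n m d (i + d, j) (i, j)"
proof (induction d)
  case 0
  then show ?case by (auto intro: walk_within_refl)
next
  case (Suc d)
  have "walk_within n m 1 (i + d, j) (i + Suc d, j)"
    by (rule walk_within_arc) (use Suc.prems in \<open>auto simp: comb_edges_def\<close>)
  moreover have "walk_within n m 1 (i + Suc d, j) (i + d, j)"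
    by (rule walk_within_arc) (use Suc.prems in \<open>auto simp: comb_edges_def\<close>)
  moreover note Suc.IH Suc.prems
  ultimately show ?case
    using walk_within_trans[of d "(i, j)" "(i + d, j)" 1 "(i + Suc d, j)" "Suc d"]
      walk_within_trans[of 1 "(i + Suc d, j)" "(i + d, j)" d "(i, j)" "Suc d"] by simp
qed

lemma walk_within_spine_asc:
  "1 \<le> j \<Longrightarrow> j + d \<le> n \<Longrightarrow>
    walk_within n m d (1, j) (1, j + d) \<and> walk_within n m d (1, j + d) (1, j)"
proof (induction d)
  case 0
  then show ?case using m_pos by (auto intro: walk_within_refl)
next
  case (Suc d)
  have "walk_within n m 1 (1, j + d) (1, j + Suc d)"
    by (rule walk_within_arc) (use Suc.prems in \<open>auto simp: comb_edges_def\<close>)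
  moreover have "walk_within n m 1 (1, j + Suc d) (1, j + d)"
    by (rule walk_within_arc) (use Suc.prems in \<open>auto simp: comb_edges_def\<close>)
  moreover note Suc.IH Suc.prems
  ultimately show ?case
    using walk_within_trans[of d "(1, j)" "(1, j + d)" 1 "(1, j + Suc d)" "Suc d"]
      walk_within_trans[of 1 "(1, j + Suc d)" "(1, j + d)" d "(1, j)" "Suc d"] by simp
qed

lemma walk_within_tooth:
  assumes "i \<in> {1..m}" "i' \<in> {1..m}" "j \<in> {1..n}" "\<bar>int i' - int i\<bar> \<le> int r"
  shows "walk_within n m r (i, j) (i', j)"
proof -
  have "walk_within n m (nat \<bar>int i' - int i\<bar>) (i, j) (i', j)"
  proof (cases "i \<le> i'")
    case True
    then show ?thesis
      using walk_within_tooth_asc[of i "i' - i" j] assms by (auto simp: nat_diff_distrib)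
  next
    case False
    then show ?thesis
      using walk_within_tooth_asc[of i' "i - i'" j] assms by (auto simp: nat_diff_distrib)
  qed
  with assms(4) show ?thesis unfolding walk_within_def by fastforce
qed

lemma walk_within_from_spine:
  assumes "i \<in> {1..m}" "j \<in> {1..n}" "j' \<in> {1..n}" "\<bar>int j' - int j\<bar> + int i \<le> int r + 1"
  shows "walk_within n m r (1, j) (i, j')"
proof -
  have "walk_within n m (nat \<bar>int j' - int j\<bar>) (1, j) (1, j')"
  proof (cases "j \<le> j'")
    case True
    then show ?thesis
      using walk_within_spine_asc[of j "j' - j"] assms by (auto simp: nat_diff_distrib)
  next
    case False
    then show ?thesis
      using walk_within_spine_asc[of j' "j - j'"] assms by (auto simp: nat_diff_distrib)
  qed
  moreover have "walk_within n m (i - 1) (1, j') (i, j')"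
    using assms m_pos by (intro walk_within_tooth) auto
  ultimately show ?thesis
    by (rule walk_within_trans) (use assms(1,4) in auto)
qed

section \<open>Three ways to cover the comb by balls\<close>

text \<open>Centres are indexed by radius rather than by position: position \<open>i\<close> of a
  burning sequence has radius \<open>k - i\<close>.\<close>

lemma burning_number_comb_le:
  assumes verts: "\<And>r. r < k \<Longrightarrow> c r \<in> {1..m} \<times> {1..n}"
    and cover: "\<And>i j. i \<in> {1..m} \<Longrightarrow> j \<in> {1..n} \<Longrightarrow> \<exists>r<k. walk_within n m r (c r) (i, j)"
  shows "burning_number (with_proj (comb_graph n m)) \<le> k"
proof -
  let ?G = "with_proj (comb_graph n m)"
  have vG: "verts ?G = {1..m} \<times> {1..n}"
    by (simp add: comb_graph_def)
  have ball: "graph_ball ?G u r = {w \<in> {1..m} \<times> {1..n}. walk_within n m r u w}" for u r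
    unfolding graph_ball_def walk_within_def vG
    using graph_dist_le_iff[OF wf_digraph_axioms] by simp
  have "burning_seq ?G k (\<lambda>i. c (k - i))"
    unfolding burning_seq_def ball vG
  proof (intro conjI ballI equalityI subsetI)
    fix u assume u: "u \<in> {1..m} \<times> {1..n}"
    then obtain i j where "u = (i, j)" "i \<in> {1..m}" "j \<in> {1..n}" by blast
    then obtain r where "r < k" "walk_within n m r (c r) u" using cover by blast
    then show "u \<in> (\<Union>i\<in>{1..k}. {w \<in> {1..m} \<times> {1..n}. walk_within n m (k - i) (c (k - i)) w})"
      using u by (intro UN_I[of "k - r"]) auto
  qed (use verts in auto)
  then show ?thesis
    unfolding burning_number_def by (intro Least_le) blast
qed

lemma burning_number_comb_path:
  assumes "n = 1" "m \<le> k ^ 2"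
  shows "burning_number (with_proj (comb_graph n m)) \<le> k"
proof -
  have "int m \<le> (\<Sum>r<k. 2 * int r + 1)"
    using assms(2) unfolding sum_odd_int by (metis of_nat_le_iff of_nat_power)
  from interval_cover_within[OF finite_lessThan this m_pos]
  obtain c where c': "\<forall>r. c r \<in> {1..m}"
    "\<forall>x\<in>{1..m}. int m - int m < int x \<longrightarrow> (\<exists>r\<in>{..<k}. \<bar>int x - int (c r)\<bar> \<le> int r)"
    by blast
  have c: "c r \<in> {1..m}" "x \<in> {1..m} \<Longrightarrow> \<exists>r<k. \<bar>int x - int (c r)\<bar> \<le> int r" for r x
    using c' by auto
  show ?thesis
  proof (rule burning_number_comb_le[where c = "\<lambda>r. (c r, 1)"])
    fix i j assume ij: "i \<in> {1..m}" "j \<in> {1..n}"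
    then obtain r where r: "r < k" "\<bar>int i - int (c r)\<bar> \<le> int r" using c(2) by blast
    have "j = 1" using ij(2) assms(1) by simp
    with r ij c(1) show "\<exists>r<k. walk_within n m r (c r, 1) (i, j)"
      using walk_within_tooth by blast
  qed (use c(1) assms in auto)
qed

text \<open>A ball of radius \<open>s + m - 1\<close> about a spine vertex contains the \<open>2 s + 1\<close> nearest teeth completely.\<close>

lemma burning_number_comb_spine:
  assumes "n \<ge> 1" "m \<le> k" "n \<le> (k - m + 1) ^ 2"
  shows "burning_number (with_proj (comb_graph n m)) \<le> k"
proof -
  have "int n \<le> (\<Sum>r<k - m + 1. 2 * int r + 1)"
    using assms(3) unfolding sum_odd_int by (metis of_nat_le_iff of_nat_power)
  from interval_cover_within[OF finite_lessThan this assms(1)]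
  obtain c where c': "\<forall>r. c r \<in> {1..n}"
    "\<forall>x\<in>{1..n}. int n - int n < int x
      \<longrightarrow> (\<exists>r\<in>{..<k - m + 1}. \<bar>int x - int (c r)\<bar> \<le> int r)"
    by blast
  have c: "c r \<in> {1..n}" "x \<in> {1..n} \<Longrightarrow> \<exists>r<k - m + 1. \<bar>int x - int (c r)\<bar> \<le> int r" for r x
    using c' by auto
  show ?thesis
  \<comment> \<open>Truncated subtraction sends every radius below \<open>m - 1\<close> to
    \<open>c 0\<close>, which is still a spine position.\<close>
  proof (rule burning_number_comb_le[where c = "\<lambda>r. (1, c (r + 1 - m))"])
    fix i j assume ij: "i \<in> {1..m}" "j \<in> {1..n}"
    obtain s where s: "s < k - m + 1" "\<bar>int j - int (c s)\<bar> \<le> int s" using c(2) ij(2) by blast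
    have "walk_within n m (s + m - 1) (1, c s) (i, j)"
      using ij s c(1) m_pos by (intro walk_within_from_spine) auto
    then show "\<exists>r<k. walk_within n m r (1, c (r + 1 - m)) (i, j)"
      using s(1) assms(2) m_pos by (intro exI[of _ "s + m - 1"]) auto
  qed (use c(1) m_pos in auto)
qed

text \<open>The ball of radius \<open>k - 1\<close> about the middle of the spine leaves in each tooth a tail of
  \<open>m - k\<close> vertices plus the distance of the tooth from the middle. Numbering the teeth outwards
  from the middle, alternating sides, tooth number \<open>i\<close> is at distance \<open>(i + 1) div 2\<close>. The
  function \<open>f\<close> assigns the remaining radii to the tails.\<close>

lemma burning_number_comb_tails:
  assumes "n \<ge> 1" "k \<ge> 1"
    and f: "\<And>i. i < n \<Longrightarrow>
      int m - int k + int ((i + 1) div 2) \<le> (\<Sum>r | r < k - 1 \<and> f r = i. 2 * int r + 1)"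
  shows "burning_number (with_proj (comb_graph n m)) \<le> k"
proof -
  have "\<forall>i\<in>{..<n}. \<exists>c. (\<forall>r. c r \<in> {1..m}) \<and>
      (\<forall>x\<in>{1..m}. int m - (int m - int k + int ((i + 1) div 2)) < int x
        \<longrightarrow> (\<exists>r\<in>{r. r < k - 1 \<and> f r = i}. \<bar>int x - int (c r)\<bar> \<le> int r))"
    by (intro ballI interval_cover_within f m_pos) auto
  from bchoice[OF this] obtain c where c': "\<And>i. i < n \<Longrightarrow> (\<forall>r. c i r \<in> {1..m}) \<and>
      (\<forall>x\<in>{1..m}. int m - (int m - int k + int ((i + 1) div 2)) < int x
        \<longrightarrow> (\<exists>r\<in>{r. r < k - 1 \<and> f r = i}. \<bar>int x - int (c i r)\<bar> \<le> int r))"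
    by (auto simp only: lessThan_iff Ball_def)
  have c1: "c i r \<in> {1..m}" if "i < n" for i r
    using c'[OF that] by blast
  have c2: "\<exists>r<k - 1. f r = i \<and> \<bar>int x - int (c i r)\<bar> \<le> int r"
    if "i < n" "x \<in> {1..m}" "int k - int ((i + 1) div 2) < int x" for i x
    using c'[OF that(1)] that(2,3) by force
  define h where "h = (n + 1) div 2"
  define tooth where "tooth i = (if even i then h - i div 2 else h + (i + 1) div 2)" for i
  define num where "num j = (if j \<le> h then 2 * (h - j) else 2 * (j - h) - 1)" for j
  have h: "h \<in> {1..n}" using assms(1) unfolding h_def by auto
  have tooth: "tooth i \<in> {1..n}" if "i < n" for i
    using that unfolding tooth_def h_def by (auto elim!: evenE oddE)
  have num: "num j < n" "tooth (num j) = j" "int ((num j + 1) div 2) = \<bar>int j - int h\<bar>"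
    if "j \<in> {1..n}" for j
    using that unfolding num_def tooth_def h_def by auto
  \<comment> \<open>Radius \<open>k - 1\<close> is the large ball. A smaller radius whose value
    under \<open>f\<close> is no tooth number gets the dummy centre \<open>(1, h)\<close>.\<close>
  let ?c = "\<lambda>r. if r = k - 1 then (1, h) else if f r < n then (c (f r) r, tooth (f r)) else (1, h)"
  show ?thesis
  proof (rule burning_number_comb_le[where c = ?c])
    show "?c r \<in> {1..m} \<times> {1..n}" for r
      using h m_pos tooth c1 by auto
    fix i j assume ij: "i \<in> {1..m}" "j \<in> {1..n}"
    show "\<exists>r<k. walk_within n m r (?c r) (i, j)"
    proof (cases "int i \<le> int k - \<bar>int j - int h\<bar>")
      case True
      then have "walk_within n m (k - 1) (1, h) (i, j)"
        using ij h assms(2) by (intro walk_within_from_spine) auto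
      then show ?thesis using assms(2) by (intro exI[of _ "k - 1"]) auto
    next
      case False
      then obtain r where r: "r < k - 1" "f r = num j" "\<bar>int i - int (c (num j) r)\<bar> \<le> int r"
        using c2[of "num j" i] num ij by force
      then have "walk_within n m r (c (num j) r, j) (i, j)"
        using ij c1 num by (intro walk_within_tooth) auto
      then show ?thesis using r num ij by (intro exI[of _ r]) auto
    qed
  qed
qed

end

section \<open>Distribution of the radii among the teeth\<close>

lemma sum_odd_mono:
  assumes "A \<subseteq> B" "finite B"
  shows "(\<Sum>r\<in>A. 2 * int r + 1) \<le> (\<Sum>r\<in>B. 2 * int r + 1)"
  by (rule sum_mono2) (use assms in auto)

text \<open>Usually the \<open>n\<close> largest radii suffice, one per tooth: radius
  \<open>i + (p - n)\<close> is worth \<open>2 i + 2 (p - n) + 1\<close> vertices, and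
  \<open>(i + 1) div 2 \<le> 2 i\<close>.\<close>

lemma assign_radii_base:
  fixes t :: int
  assumes "n \<ge> 2" "n \<le> p" "p < 2 * n"
    and inv: "int n * t \<le> (int p + 1) * (int p + 1 - int n)"
  shows "\<exists>f. \<forall>i<n. t + int ((i + 1) div 2) \<le> (\<Sum>r | r < p \<and> f r = i. 2 * int r + 1)"
proof (cases "t \<le> 2 * (int p - int n) + 1")
  case True
  show ?thesis
  proof (intro exI allI impI)
    fix i assume i: "i < n"
    have "t + int ((i + 1) div 2) \<le> (\<Sum>r\<in>{i + (p - n)}. 2 * int r + 1)"
      using True assms by (simp add: of_nat_diff)
    also have "\<dots> \<le> (\<Sum>r | r < p \<and> (if r < p - n then n else r - (p - n)) = i. 2 * int r + 1)"
      using i assms by (intro sum_odd_mono) auto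
    finally show "t + int ((i + 1) div 2) \<le> \<dots>" .
  qed
next
  \<comment> \<open>Only \<open>p = 2 n - 1\<close>, \<open>t = 2 n\<close> remains: the \<open>n\<close> largest radii fall short by one vertex in the
    middle tooth, which radius \<open>0\<close> supplies.\<close>
  case False
  \<comment> \<open>Here \<open>t \<ge> 2 u\<close>, and the quadratic bound reads
    \<open>n t \<le> (n + u) u\<close>; together they force \<open>u \<ge> n\<close>.\<close>
  define u where "u = int p - int n + 1"
  have u: "0 < u" "u \<le> int n" "2 * u \<le> t" using False assms unfolding u_def by auto
  have "int n * (2 * u) \<le> int n * t" using u by (intro mult_left_mono) auto
  also have "\<dots> \<le> (int n + u) * u" using inv unfolding u_def by (simp add: algebra_simps)
  finally have "int n * u \<le> u * u" by (simp add: algebra_simps)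
  then have un: "u = int n" using u by simp
  then have p: "p = 2 * n - 1" unfolding u_def using assms by auto
  have "int n * t \<le> int n * (2 * int n)"
    using inv p assms(1) by (simp add: of_nat_diff algebra_simps)
  then have t: "t \<le> 2 * int n" using assms(1) by simp
  show ?thesis
  proof (intro exI allI impI)
    fix i assume i: "i < n"
    \<comment> \<open>The value \<open>n\<close> is no tooth number, so it discards the radii from
      \<open>1\<close> to \<open>n - 2\<close>.\<close>
    let ?R = "{r. r < p \<and> (if r = 0 then 0 else if r < n - 1 then n else r - (n - 1)) = i}"
    have "t + int ((i + 1) div 2) \<le> (\<Sum>r\<in>(if i = 0 then {0, n - 1} else {i + (n - 1)}). 2 * int r + 1)"
      using t assms by (auto simp: of_nat_diff)
    also have "\<dots> \<le> (\<Sum>r\<in>?R. 2 * int r + 1)"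
      using i assms p by (intro sum_odd_mono) auto
    finally show "t + int ((i + 1) div 2) \<le> \<dots>" .
  qed
qed

text \<open>Removing the \<open>2 n\<close> largest radii lowers every demand by \<open>4 (p - n)\<close>, and the quadratic bound
  on \<open>t\<close> is stable under this step. The last assumption is needed only when fewer than \<open>n\<close> radii
  are left, which can only happen after a step.\<close>

lemma assign_radii:
  fixes t :: int
  assumes "n \<ge> 2"
    and "int n * t \<le> (int p + 1) * (int p + 1 - int n)"
    and "n \<ge> 3 \<Longrightarrow> p < n \<Longrightarrow> t + int (n div 2) \<le> 0"
  shows "\<exists>f. \<forall>i<n. t + int ((i + 1) div 2) \<le> (\<Sum>r | r < p \<and> f r = i. 2 * int r + 1)"
  using assms(2,3)
proof (induction p arbitrary: t rule: less_induct)
  case (less p)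
  note inv = less.prems(1)
  consider "p < n" "n \<ge> 3" | "p < n" "n = 2" | "n \<le> p" "p < 2 * n" | "2 * n \<le> p"
    using assms(1) by linarith
  then show ?case
  proof cases
    case 1
    then have neg: "t + int (n div 2) \<le> 0" using less.prems(2) by blast
    have "t + int ((i + 1) div 2) \<le> (\<Sum>r | r < p \<and> r = i. 2 * int r + 1)" if "i < n" for i
    proof -
      have "(i + 1) div 2 \<le> n div 2" using that by (intro div_le_mono) auto
      then have "t + int ((i + 1) div 2) \<le> 0" using neg by linarith
      also have "0 \<le> (\<Sum>r | r < p \<and> r = i. 2 * int r + 1)" by (intro sum_nonneg) auto
      finally show ?thesis .
    qed
    then show ?thesis by (intro exI[of _ "\<lambda>r. r"] allI impI)
  next
    case 2
    then have p: "p = 0 \<or> p = 1" by linarith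
    then have t: "t \<le> int p - 1"
    proof
      assume "p = 0"
      then have "2 * t \<le> - 1" using inv 2(2) by simp
      then show ?thesis using \<open>p = 0\<close> by simp
    next
      assume "p = 1"
      then have "2 * t \<le> 0" using inv 2(2) by simp
      then show ?thesis using \<open>p = 1\<close> by simp
    qed
    \<comment> \<open>All radii go to tooth \<open>1\<close>, whose demand \<open>t + 1\<close> is
      at most \<open>p\<close>; tooth \<open>0\<close> demands at most \<open>0\<close>.\<close>
    have "t + int ((i + 1) div 2) \<le> (\<Sum>r | r < p \<and> 1 = i. 2 * int r + 1)" if "i < n" for i
    proof (cases "i = 1")
      case True
      then have "{r. r < p \<and> 1 = i} = {..<p}" by auto
      then have "(\<Sum>r | r < p \<and> 1 = i. 2 * int r + 1) = int p ^ 2"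
        using sum_odd_int by simp
      then show ?thesis using t True p by (elim disjE) simp_all
    next
      case False
      then have "i = 0" using that 2(2) by auto
      then show ?thesis using t p by (elim disjE) simp_all
    qed
    then show ?thesis by (intro exI[of _ "\<lambda>_. 1"] allI impI)
  next
    case 3
    then show ?thesis using assign_radii_base[OF assms(1)] inv by blast
  next
    case 4
    \<comment> \<open>Tooth \<open>i\<close> will receive the radii \<open>i + q\<close> and
      \<open>p - 1 - i\<close>, worth \<open>4 (p - n)\<close> vertices for every
      \<open>i\<close>.\<close>
    define t' where "t' = t - 4 * (int p - int n)"
    define q where "q = p - 2 * n"
    have q: "int q = int p - 2 * int n" using 4 unfolding q_def by (simp add: of_nat_diff)
    \<comment> \<open>This is exactly the slack gained in the quadratic bound by passing to
      \<open>t'\<close> and \<open>q\<close>.\<close>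
    have "0 \<le> 2 * int n * (int n - 2)" using assms(1) by simp
    then have inv': "int n * t' \<le> (int q + 1) * (int q + 1 - int n)"
      using inv unfolding t'_def q by (simp add: algebra_simps)
    have "t' + int (n div 2) \<le> 0" if n3: "n \<ge> 3" and qn: "q < n"
    proof -
      define u where "u = int q + 1"
      have u: "0 < u" "u \<le> int n" using qn unfolding u_def by auto
      have "int p + 1 = 2 * int n + u" using q unfolding u_def by simp
      then have "int n * t \<le> (2 * int n + u) * (int n + u)"
        using inv by simp
      also have "\<dots> \<le> int n * (2 * int n + 4 * u)"
        using u mult_right_mono[of u "int n" u] by (simp add: algebra_simps)
      finally have "t \<le> 2 * int n + 4 * u" using assms(1) by simp
      then have "t' \<le> 4 - 2 * int n" unfolding t'_def using q u_def by presburger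
      \<comment> \<open>\<open>n div 2 \<le> 2 n - 4\<close> fails for \<open>n = 2\<close>, hence
        the separate case above.\<close>
      then show ?thesis using n3 by linarith
    qed
    moreover have "q < p" using 4 assms(1) unfolding q_def by simp
    ultimately obtain g where g: "\<And>i. i < n \<Longrightarrow>
        t' + int ((i + 1) div 2) \<le> (\<Sum>r | r < q \<and> g r = i. 2 * int r + 1)"
      using less.IH[OF _ inv'] by blast
    define f where "f r = (if r < q then g r else if r < q + n then r - q else p - 1 - r)" for r
    have "t + int ((i + 1) div 2) \<le> (\<Sum>r | r < p \<and> f r = i. 2 * int r + 1)" if i: "i < n" for i
    proof -
      let ?A = "{r. r < q \<and> g r = i}" and ?B = "{i + q, p - 1 - i}"
      have pq: "p = q + 2 * n" using 4 q_def by simp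
      have "t + int ((i + 1) div 2) = t' + int ((i + 1) div 2) + (\<Sum>r\<in>?B. 2 * int r + 1)"
        using i 4 pq unfolding t'_def by (auto simp: of_nat_diff)
      also have "\<dots> \<le> (\<Sum>r\<in>?A. 2 * int r + 1) + (\<Sum>r\<in>?B. 2 * int r + 1)"
        using g[OF i] by simp
      also have "\<dots> = (\<Sum>r\<in>?A \<union> ?B. 2 * int r + 1)"
        by (rule sum.union_disjoint[symmetric]) (use i pq in auto)
      also have "\<dots> \<le> (\<Sum>r | r < p \<and> f r = i. 2 * int r + 1)"
        using i pq by (intro sum_odd_mono) (auto simp: f_def)
      finally show ?thesis .
    qed
    then show ?thesis by (intro exI[of _ f] allI impI)
  qed
qed

text \<open>With \<open>s = k - m\<close>, the demand \<open>(i + 1) div 2 - s\<close> is positive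
  only from \<open>i = 2 s + 1\<close> on. Tooth \<open>2 s + 1 + r\<close> gets radius
  \<open>r\<close>, as \<open>1 + r div 2 \<le> 2 r + 1\<close>; the bounds on \<open>n\<close> and
  \<open>m\<close> keep \<open>r\<close> below \<open>k - 1\<close>.\<close>

lemma assign_radii_short_teeth:
  assumes "m \<le> k" "n + m \<le> 2 * k" "m \<ge> 1"
  shows "\<exists>f. \<forall>i<n. int m - int k + int ((i + 1) div 2) \<le> (\<Sum>r | r < k - 1 \<and> f r = i. 2 * int r + 1)"
proof (intro exI allI impI)
  fix i assume i: "i < n"
  let ?s = "k - m"
  let ?f = "\<lambda>r. 2 * ?s + 1 + r"
  show "int m - int k + int ((i + 1) div 2) \<le> (\<Sum>r | r < k - 1 \<and> ?f r = i. 2 * int r + 1)"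
  proof (cases "i \<le> 2 * ?s")
    case True
    then have "int m - int k + int ((i + 1) div 2) \<le> 0" using assms(1) by linarith
    also have "0 \<le> (\<Sum>r | r < k - 1 \<and> ?f r = i. 2 * int r + 1)" by (intro sum_nonneg) auto
    finally show ?thesis .
  next
    case False
    have "int m - int k + int ((i + 1) div 2) \<le> (\<Sum>r\<in>{i - 2 * ?s - 1}. 2 * int r + 1)"
      using False assms(1) by auto
    also have "\<dots> \<le> (\<Sum>r | r < k - 1 \<and> ?f r = i. 2 * int r + 1)"
      using False i assms by (intro sum_odd_mono) auto
    finally show ?thesis .
  qed
qed

section \<open>Choosing the covering\<close>

text \<open>With \<open>s = k - m\<close>, \<open>n \<ge> m + 2 s + 1\<close> and
  \<open>n m \<le> (m + s)^2\<close> give \<open>m \<le> s^2\<close>, hence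
  \<open>(m + s)^2 \<le> (s + 1)^2 m\<close>; then \<open>m\<close> cancels.\<close>

lemma wide_comb_le_square:
  fixes n m k :: nat
  assumes "m \<ge> 1" "m \<le> k" "2 * k < n + m" "n * m \<le> k ^ 2"
  shows "n \<le> (k - m + 1) ^ 2"
proof -
  define M N s where "M = int m" and "N = int n" and "s = int k - int m"
  have h: "M \<ge> 1" "s \<ge> 0" "N \<ge> M + 2 * s + 1"
    using assms unfolding M_def N_def s_def by auto
  have le: "N * M \<le> (M + s) ^ 2"
    using assms(4) unfolding M_def N_def s_def
    by (metis add_diff_cancel_left' diff_add_cancel of_nat_le_iff of_nat_mult of_nat_power)
  have "(M + 2 * s + 1) * M \<le> N * M" using h by (intro mult_right_mono) auto
  with le have Ms: "M \<le> s ^ 2" by (simp add: power2_eq_square algebra_simps)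
  \<comment> \<open>The product equals \<open>(s + 1)^2 M - (M + s)^2\<close>.\<close>
  have "0 \<le> (M - 1) * (s ^ 2 - M)" using h Ms by simp
  then have "(M + s) ^ 2 \<le> (s + 1) ^ 2 * M" by (simp add: power2_eq_square algebra_simps)
  with le have "N * M \<le> (s + 1) ^ 2 * M" by linarith
  then have "N \<le> (s + 1) ^ 2" using h by simp
  also have "(s + 1) ^ 2 = int ((k - m + 1) ^ 2)"
    using assms(2) unfolding s_def by (simp add: of_nat_diff)
  finally show ?thesis unfolding N_def by linarith
qed

lemma burning_number_comb_square:
  assumes "n \<ge> 1" "m \<ge> 1" "n * m \<le> k ^ 2"
  shows "burning_number (with_proj (comb_graph n m)) \<le> k"
proof -
  have k: "k \<ge> 1" using assms by (cases k) auto
  consider "n = 1" | "m \<le> k" "n + m \<le> 2 * k" | "m \<le> k" "2 * k < n + m" | "n \<ge> 2" "k < m"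
    using assms(1) by linarith
  then show ?thesis
  proof cases
    case 1
    then show ?thesis using assms(3) by (intro burning_number_comb_path[OF assms(2)]) simp_all
  next
    case 2
    from assign_radii_short_teeth[OF 2 assms(2)]
    obtain f where f: "\<forall>i<n. int m - int k + int ((i + 1) div 2)
        \<le> (\<Sum>r | r < k - 1 \<and> f r = i. 2 * int r + 1)" ..
    show ?thesis
      by (rule burning_number_comb_tails[OF assms(2,1) k f[rule_format]])
  next
    case 3
    from wide_comb_le_square[OF assms(2) 3 assms(3)] show ?thesis
      by (rule burning_number_comb_spine[OF assms(2,1) 3(1)])
  next
    case 4
    have "int n * int m \<le> int k * int k"
      using assms(3) by (metis of_nat_le_iff of_nat_mult power2_eq_square)
    \<comment> \<open>For \<open>p = k - 1\<close> and \<open>t = m - k\<close> the bound in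
      \<open>assign_radii\<close> is just \<open>n m \<le> k^2\<close>.\<close>
    then have inv: "int n * (int m - int k) \<le> (int (k - 1) + 1) * (int (k - 1) + 1 - int n)"
      using k by (simp add: of_nat_diff algebra_simps)
    \<comment> \<open>At least \<open>n\<close> radii remain, so the last assumption of
      \<open>assign_radii\<close> holds vacuously.\<close>
    have "n * k < n * m" using 4 by simp
    also have "\<dots> \<le> k * k" using assms(3) by (simp add: power2_eq_square)
    finally have "n < k" by simp
    then have "\<not> k - 1 < n" by simp
    then have "\<exists>f. \<forall>i<n. int m - int k + int ((i + 1) div 2)
        \<le> (\<Sum>r | r < k - 1 \<and> f r = i. 2 * int r + 1)"
      by (intro assign_radii[OF 4(1) inv]) simp
    then obtain f where f: "\<forall>i<n. int m - int k + int ((i + 1) div 2)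
        \<le> (\<Sum>r | r < k - 1 \<and> f r = i. 2 * int r + 1)" ..
    show ?thesis
      by (rule burning_number_comb_tails[OF assms(2,1) k f[rule_format]])
  qed
qed

theorem theorem1p4:
  fixes n m :: nat
  assumes "n \<ge> 1" and "m \<ge> 1"
  shows "int (burning_number (with_proj (comb_graph n m))) \<le> \<lceil>sqrt (real (n * m))\<rceil>"
proof -
  define k where "k = nat \<lceil>sqrt (real (n * m))\<rceil>"
  have "sqrt (real (n * m)) \<le> real k" unfolding k_def by linarith
  then have "real (n * m) \<le> real k ^ 2" by (rule sqrt_le_D)
  then have "n * m \<le> k ^ 2" by (metis of_nat_le_iff of_nat_power)
  then have "burning_number (with_proj (comb_graph n m)) \<le> k"
    by (rule burning_number_comb_square[OF assms])
  moreover have "0 \<le> \<lceil>sqrt (real (n * m))\<rceil>" by (simp add: order_less_le_trans[of "-1" 0])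
  ultimately show ?thesis unfolding k_def by linarith
qed

end
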